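(* Let $X\subset\mathbb{P}^{107}=\mathbb{P}(\mathbb{C}^3\otimes\mathbb{C}^6\otimes\mathbb{C}^6)$ be the Segre embedding of $\mathbb{P}^2\times\mathbb{P}^5\times\mathbb{P}^5$. For $8$ general points $x_1,\dots,x_8$ of $X$, there exists a fourfold $Y\subset X$ containing $x_1,\dots,x_8$ such that $Y$ is the image of an embedding of $\mathbb{P}^2\times\mathbb{P}^1\times\mathbb{P}^1$ into a linear subspace $\mathbb{P}^{39}\subset\mathbb{P}^{107}$ given by the divisors of multidegree $(3,1,1)$.
   Context: We work over $\mathbb{C}$. The embedding by divisors of multidegree $(3,1,1)$ is the Segre–Veronese embedding of $\mathbb{P}^2\times\mathbb{P}^1\times\mathbb{P}^1$ given by the complete linear system $|\mathcal{O}(3,1,1)|$, whose space of sections has dimension $40$. "General" means that the property holds for $(x_1,\dots,x_8)$ in a nonempty Zariski open subset of $X^8$. *)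

theory Defs
  imports "HOL-Analysis.Analysis"
begin

text \<open>Points of \<open>\<PP>(\<complex>\<^sup>n)\<close> are lines through the origin of \<open>complex ^ 'n\<close>, where \<open>CARD('n) = n\<close>
  (so \<open>\<PP>\<^sup>2\<close> has index type \<open>3\<close>). Linear algebra over \<open>complex\<close> uses the \<open>vec\<close> interpretation; the
  unqualified \<open>span\<close>, \<open>dim\<close> etc. are over \<open>real\<close>.\<close>

definition proj_pt :: "complex ^ 'n \<Rightarrow> (complex ^ 'n) set" where
  "proj_pt v = vec.span {v}"

definition proj_space :: "(complex ^ 'n) set set" where
  "proj_space = {proj_pt v | v. v \<noteq> 0}"

definition tensor3 ::
  "complex ^ 'a \<Rightarrow> complex ^ 'b \<Rightarrow> complex ^ 'c \<Rightarrow> complex ^ ('a \<times> 'b \<times> 'c)" where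
  "tensor3 u v w = (\<chi> p. case p of (i, j, k) \<Rightarrow> u $ i * v $ j * w $ k)"

definition segre_variety :: "(complex ^ ('a::finite \<times> 'b::finite \<times> 'c::finite)) set set" where
  "segre_variety = {proj_pt (tensor3 u v w) | u v w. u \<noteq> 0 \<and> v \<noteq> 0 \<and> w \<noteq> 0}"

text \<open>\<open>multiform d f\<close>: \<open>f\<close> is a multihomogeneous polynomial on \<open>(\<complex>\<^sup>n)\<^sup>k\<close>, of degree \<open>d i\<close> in the
  coordinates of the \<open>i\<close>-th factor. Polynomials are identified with polynomial functions, as the
  ground field is infinite.\<close>

inductive multiform :: "('k \<Rightarrow> nat) \<Rightarrow> (('k \<Rightarrow> complex ^ 'n) \<Rightarrow> complex) \<Rightarrow> bool" where
  const: "multiform (\<lambda>_. 0) (\<lambda>_. c)"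
| coord: "multiform (\<lambda>i'. if i' = i then 1 else 0) (\<lambda>x. x i $ j)"
| add: "multiform d f \<Longrightarrow> multiform d g \<Longrightarrow> multiform d (\<lambda>x. f x + g x)"
| mult: "multiform d f \<Longrightarrow> multiform e g \<Longrightarrow> multiform (\<lambda>i. d i + e i) (\<lambda>x. f x * g x)"

text \<open>The Zariski topology on \<open>(\<PP>\<^sup>n)\<^sup>k\<close>, generated by the complements of the hypersurfaces \<open>f = 0\<close>. This
  is not the product of the Zariski topologies of the factors.\<close>

definition basic_open ::
  "(('k \<Rightarrow> complex ^ 'n) \<Rightarrow> complex) \<Rightarrow> ('k \<Rightarrow> (complex ^ 'n) set) set" where
  "basic_open f = {\<lambda>i. proj_pt (v i) | v. (\<forall>i. v i \<noteq> 0) \<and> f v \<noteq> 0}"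

definition zariski :: "('k \<Rightarrow> (complex ^ 'n) set) topology" where
  "zariski = topology_generated_by {basic_open f | f. \<exists>d. multiform d f}"

text \<open>The space of sections of \<open>\<O>(3,1,1)\<close> on \<open>\<PP>\<^sup>2 \<times> \<PP>\<^sup>1 \<times> \<PP>\<^sup>1\<close>: forms of multidegree \<open>(3,1,1)\<close>.\<close>

definition sections_3_1_1 :: "(complex ^ 3 \<Rightarrow> complex ^ 2 \<Rightarrow> complex ^ 2 \<Rightarrow> complex) set" where
  "sections_3_1_1 =
    {\<lambda>u v w. \<Sum>i\<in>UNIV. \<Sum>j\<in>UNIV. \<Sum>k\<in>UNIV. \<Sum>l\<in>UNIV. \<Sum>m\<in>UNIV.
        c i j k l m * (u $ i * u $ j * u $ k) * v $ l * w $ m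
     | c :: 3 \<Rightarrow> 3 \<Rightarrow> 3 \<Rightarrow> 2 \<Rightarrow> 2 \<Rightarrow> complex. True}"

definition section_basis ::
  "('m::finite \<Rightarrow> complex ^ 3 \<Rightarrow> complex ^ 2 \<Rightarrow> complex ^ 2 \<Rightarrow> complex) \<Rightarrow> bool" where
  "section_basis s \<longleftrightarrow>
    (\<forall>m. s m \<in> sections_3_1_1) \<and>
    (\<forall>f\<in>sections_3_1_1. \<exists>!c. f = (\<lambda>u v w. \<Sum>m\<in>UNIV. c m * s m u v w))"

text \<open>\<open>\<phi>\<close> is the embedding of \<open>\<PP>\<^sup>2 \<times> \<PP>\<^sup>1 \<times> \<PP>\<^sup>1\<close> into the linear subspace \<open>\<PP>(\<Lambda>)\<close>, \<open>\<Lambda>\<close> of dimension 40, by the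
  complete linear system of \<open>\<O>(3,1,1)\<close>: the homogeneous coordinates of \<open>\<phi>\<close>, with respect to some
  basis \<open>b\<close> of \<open>\<Lambda>\<close>, form a basis \<open>s\<close> of the space of sections. Since \<open>\<O>(3,1,1)\<close> is very ample,
  such a map is a closed immersion; in particular the injectivity clause is not a restriction.\<close>

definition embedding_by_3_1_1 ::
  "(complex ^ 'n) set \<Rightarrow>
   ((complex ^ 3) set \<times> (complex ^ 2) set \<times> (complex ^ 2) set \<Rightarrow> (complex ^ 'n) set) \<Rightarrow> bool" where
  "embedding_by_3_1_1 \<Lambda> \<phi> \<longleftrightarrow>
    inj_on \<phi> (proj_space \<times> proj_space \<times> proj_space) \<and>
    (\<exists>(b :: 40 \<Rightarrow> complex ^ 'n) s.
       inj b \<and> vec.independent (range b) \<and> vec.span (range b) = \<Lambda> \<and>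
       section_basis s \<and>
       (\<forall>u v w. u \<noteq> 0 \<and> v \<noteq> 0 \<and> w \<noteq> 0 \<longrightarrow>
          \<phi> (proj_pt u, proj_pt v, proj_pt w) = proj_pt (\<Sum>m\<in>UNIV. s m u v w *s b m)))"

end

theory Submission
  imports Defs
begin

text \<open>
  For injective \<open>M, N : \<complex>\<^sup>3 \<otimes> \<complex>\<^sup>2 \<rightarrow> \<complex>\<^sup>6\<close>, the map
  \<open>(u, v, w) \<mapsto> u \<otimes> M(u \<otimes> v) \<otimes> N(u \<otimes> w)\<close> embeds \<open>\<PP>\<^sup>2 \<times> \<PP>\<^sup>1 \<times> \<PP>\<^sup>1\<close> into \<open>X\<close> by \<open>\<O>(3,1,1)\<close>. Hence it
  suffices to find, for 8 general pairs \<open>(a\<^sub>k, b\<^sub>k) \<in> \<PP>\<^sup>2 \<times> \<PP>\<^sup>5\<close>, points \<open>v\<^sub>k\<close> and an injective \<open>M\<close> with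
  \<open>M(a\<^sub>k \<otimes> v\<^sub>k) \<sim> b\<^sub>k\<close>. Such an \<open>M\<close> exists as soon as the \<open>a\<^sub>k \<otimes> v\<^sub>k\<close> span and satisfy the two linear
  relations \<open>r\<close> of the \<open>b\<^sub>k\<close> (Gale duality). Each coordinate of the family \<open>(v\<^sub>k)\<close> must solve the six
  linear equations \<open>\<Sum>\<^sub>k r\<^sub>k p\<^sub>k a\<^sub>k = 0\<close> in eight unknowns \<open>p\<close>, so the solution space has dimension two and
  a basis of it provides \<open>v\<close>. Solving by Cramer's rule makes all genericity conditions multihomogeneous
  polynomials.
\<close>

section \<open>Tensors and projective points\<close>

definition tensor2 :: "complex ^ 'a \<Rightarrow> complex ^ 'b \<Rightarrow> complex ^ ('a \<times> 'b)" where
  "tensor2 u v = (\<chi> p. u $ fst p * v $ snd p)"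

lemma tensor2_nth [simp]: "tensor2 u v $ p = u $ fst p * v $ snd p"
  by (simp add: tensor2_def)

lemma tensor3_nth [simp]: "tensor3 u v w $ (i, j, k) = u $ i * v $ j * w $ k"
  by (simp add: tensor3_def)

lemma proj_pt_scale:
  assumes "c \<noteq> 0"
  shows "proj_pt (c *s v) = proj_pt v"
proof -
  have "v = inverse c *s (c *s v)" using assms by simp
  then have "v \<in> vec.span {c *s v}" by (metis vec.span_base vec.span_scale singletonI)
  moreover have "c *s v \<in> vec.span {v}" by (simp add: vec.span_base vec.span_scale)
  ultimately show ?thesis by (simp add: proj_pt_def vec.span_eq)
qed

lemma proj_pt_eqE:
  assumes "proj_pt v = proj_pt w" "v \<noteq> 0"
  obtains c where "c \<noteq> 0" "v = c *s w"
proof -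
  have "v \<in> proj_pt w" using assms(1) vec.span_base[of v "{v}"] by (simp add: proj_pt_def)
  then obtain c where "v = c *s w" by (auto simp: proj_pt_def vec.span_singleton)
  then show ?thesis using that assms(2) by force
qed

lemma tensor2_scale [simp]:
  "tensor2 (c *s u) v = c *s tensor2 u v" "tensor2 u (c *s v) = c *s tensor2 u v"
  by (simp_all add: vec_eq_iff)

lemma tensor3_scale [simp]:
  "tensor3 (c *s u) v w = c *s tensor3 u v w"
  "tensor3 u (c *s v) w = c *s tensor3 u v w"
  "tensor3 u v (c *s w) = c *s tensor3 u v w"
  by (simp_all add: vec_eq_iff)

lemma tensor2_eq_0_iff: "tensor2 u v = 0 \<longleftrightarrow> u = 0 \<or> v = 0"
  by (auto simp: vec_eq_iff)

lemma tensor3_eq_0_iff: "tensor3 u v w = 0 \<longleftrightarrow> u = 0 \<or> v = 0 \<or> w = 0"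
  by (auto simp: vec_eq_iff)

text \<open>Proportionality is cross-multiplied: in the uses below, \<open>x\<close> is a nonzero
  coordinate, or a product of such, of the remaining tensor factors.\<close>

lemma proj_pt_eqI:
  assumes "\<And>i. x * u $ i = y * u' $ i" "x \<noteq> 0" "u \<noteq> 0"
  shows "proj_pt u = proj_pt u'"
proof -
  have u: "u = (y / x) *s u'" using assms by (simp add: vec_eq_iff field_simps)
  with \<open>u \<noteq> 0\<close> have "y / x \<noteq> 0" by auto
  then show ?thesis unfolding u by (rule proj_pt_scale)
qed

lemma proj_pt_tensor2_eqD:
  assumes "proj_pt (tensor2 u v) = proj_pt (tensor2 u' v')" "u \<noteq> 0" "v \<noteq> 0"
  shows "proj_pt v = proj_pt v'"
proof -
  obtain c where c: "tensor2 u v = c *s tensor2 u' v'"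
    using assms by (metis proj_pt_eqE tensor2_eq_0_iff)
  obtain i where "u $ i \<noteq> 0" using assms by (auto simp: vec_eq_iff)
  moreover have "u $ i * v $ j = (c * u' $ i) * v' $ j" for j
    using arg_cong[OF c, of "\<lambda>t. t $ (i, j)"] by (simp add: mult_ac)
  ultimately show ?thesis using assms by (intro proj_pt_eqI)
qed

text \<open>Injectivity of the Segre embedding: fixing nonzero coordinates of two factors leaves a
  proportionality for the third.\<close>

lemma proj_pt_tensor3_eqD:
  assumes "proj_pt (tensor3 u v w) = proj_pt (tensor3 u' v' w')" "u \<noteq> 0" "v \<noteq> 0" "w \<noteq> 0"
  shows "proj_pt u = proj_pt u'" "proj_pt v = proj_pt v'" "proj_pt w = proj_pt w'"
proof -
  obtain c where c: "tensor3 u v w = c *s tensor3 u' v' w'"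
    using assms by (metis proj_pt_eqE tensor3_eq_0_iff)
  have eq: "u $ i * v $ j * w $ k = c * u' $ i * v' $ j * w' $ k" for i j k
    using arg_cong[OF c, of "\<lambda>t. t $ (i, j, k)"] by (simp add: mult_ac)
  obtain i j k where nz: "u $ i \<noteq> 0" "v $ j \<noteq> 0" "w $ k \<noteq> 0"
    using assms(2-4) by (auto simp: vec_eq_iff)
  show "proj_pt u = proj_pt u'"
    by (rule proj_pt_eqI[of "v $ j * w $ k" _ "c * v' $ j * w' $ k"])
      (use eq[of _ j k] nz assms in \<open>auto simp: mult_ac\<close>)
  show "proj_pt v = proj_pt v'"
    by (rule proj_pt_eqI[of "u $ i * w $ k" _ "c * u' $ i * w' $ k"])
      (use eq[of i _ k] nz assms in \<open>auto simp: mult_ac\<close>)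
  show "proj_pt w = proj_pt w'"
    by (rule proj_pt_eqI[of "u $ i * v $ j" _ "c * u' $ i * v' $ j"])
      (use eq[of i j] nz assms in \<open>auto simp: mult_ac\<close>)
qed

lemma proj_pt_matrix_eqD:
  assumes "proj_pt (M *v x) = proj_pt (M *v y)" "inj ((*v) M)" "x \<noteq> 0"
  shows "proj_pt x = proj_pt y"
proof -
  have "M *v x \<noteq> 0" using assms(2,3) by (metis injD matrix_vector_mult_0_right)
  then obtain c where "c \<noteq> 0" "M *v x = c *s (M *v y)" using assms(1) proj_pt_eqE by blast
  then have "M *v x = M *v (c *s y)" by (simp add: vector_scalar_commute)
  then show ?thesis using assms(2) \<open>c \<noteq> 0\<close> proj_pt_scale by (metis injD)
qed

section \<open>The linear map id \<otimes> M \<otimes> N on triple tensors\<close>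

definition tensor_map ::
  "complex ^ 'b ^ 'y \<Rightarrow> complex ^ 'c ^ 'z \<Rightarrow>
    complex ^ ('a::finite \<times> 'b::finite \<times> 'c::finite) \<Rightarrow>
    complex ^ ('a \<times> 'y::finite \<times> 'z::finite)" where
  "tensor_map M N t =
    (\<chi> p. case p of (i, y, z) \<Rightarrow> (M *v (\<chi> j. (N *v (\<chi> k. t $ (i, j, k))) $ z)) $ y)"

lemma tensor_map_nth [simp]:
  "tensor_map M N t $ (i, y, z) = (M *v (\<chi> j. (N *v (\<chi> k. t $ (i, j, k))) $ z)) $ y"
  by (simp add: tensor_map_def)

lemma tensor_map_tensor3: "tensor_map M N (tensor3 u v w) = tensor3 u (M *v v) (N *v w)"
  by (auto simp: vec_eq_iff matrix_vector_mult_def sum_distrib_left sum_distrib_right mult_ac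
      intro!: sum.cong)

lemma tensor_map_sum_scale:
  fixes t :: "'i \<Rightarrow> complex ^ ('a::finite \<times> 'b::finite \<times> 'c::finite)"
  shows "tensor_map M N (\<Sum>i\<in>S. c i *s t i) = (\<Sum>i\<in>S. c i *s tensor_map M N (t i))"
proof -
  have "tensor_map M N (s + t) = tensor_map M N s + tensor_map M N t"
    for s t :: "complex ^ ('a \<times> 'b \<times> 'c)"
    by (auto simp: vec_eq_iff matrix_vector_mult_def sum.distrib algebra_simps)
  moreover have "tensor_map M N (c *s t) = c *s tensor_map M N t" for c and t :: "complex ^ ('a \<times> 'b \<times> 'c)"
    by (auto simp: vec_eq_iff matrix_vector_mult_def sum_distrib_left mult_ac intro!: sum.cong)
  moreover have "tensor_map M N (0 :: complex ^ ('a \<times> 'b \<times> 'c)) = 0"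
    by (auto simp: vec_eq_iff matrix_vector_mult_def)
  ultimately show ?thesis
    by (induction S rule: infinite_finite_induct) auto
qed

text \<open>For equal images, \<open>M\<close> is cancelled for each fixed first and third index,
  then \<open>N\<close> on each slice of the original tensors.\<close>

lemma inj_tensor_map:
  assumes "inj ((*v) M)" "inj ((*v) N)"
  shows "inj (tensor_map M N)"
proof (rule injI)
  fix s t assume eq: "tensor_map M N s = tensor_map M N t"
  have "M *v (\<chi> j. (N *v (\<chi> k. s $ (i, j, k))) $ z) = M *v (\<chi> j. (N *v (\<chi> k. t $ (i, j, k))) $ z)"
    for i z
    using arg_cong[OF eq, of "\<lambda>r. r $ (i, y, z)" for y] by (simp add: vec_eq_iff)
  then have "(\<chi> j. (N *v (\<chi> k. s $ (i, j, k))) $ z) = (\<chi> j. (N *v (\<chi> k. t $ (i, j, k))) $ z)" for i z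
    using injD[OF assms(1)] by blast
  then have "N *v (\<chi> k. s $ (i, j, k)) = N *v (\<chi> k. t $ (i, j, k))" for i j
    by (simp add: vec_eq_iff)
  then have "(\<chi> k. s $ (i, j, k)) = (\<chi> k. t $ (i, j, k))" for i j
    using injD[OF assms(2)] by blast
  then show "s = t" by (auto simp: vec_eq_iff)
qed

section \<open>Sections of \<open>\<O>(3,1,1)\<close>\<close>

text \<open>With the weights 0, 1, 4 the ten cubic monomials in three variables have distinct weights, so a
  cubic monomial is encoded by its weight \<open>\<alpha>\<close>, and the substitution \<open>u \<mapsto> (1, t, t\<^sup>4)\<close> turns it into
  \<open>t\<^sup>\<alpha>\<close>. The variable with weight 0 is \<open>u $ 3\<close>.\<close>

definition weight :: "3 \<Rightarrow> nat" where
  "weight i = (if i = 1 then 1 else if i = 2 then 4 else 0)"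

definition weight3 :: "3 \<times> 3 \<times> 3 \<Rightarrow> nat" where
  "weight3 p = (case p of (i, j, k) \<Rightarrow> weight i + weight j + weight k)"

text \<open>The exponents of \<open>u $ 1\<close> and \<open>u $ 2\<close> are the base-4 digits of
  the weight, since each variable occurs at most three times in a cubic monomial.\<close>

definition cubic :: "nat \<Rightarrow> complex ^ 3 \<Rightarrow> complex" where
  "cubic \<alpha> u = u $ 3 ^ (3 - \<alpha> mod 4 - \<alpha> div 4) * u $ 1 ^ (\<alpha> mod 4) * u $ 2 ^ (\<alpha> div 4)"

lemma weight_simps [simp]: "weight 1 = 1" "weight 2 = 4" "weight 3 = 0"
  by (simp_all add: weight_def)

lemma cubic_simps:
  "cubic 0 u = u $ 3 * (u $ 3 * u $ 3)" "cubic 1 u = u $ 1 * (u $ 3 * u $ 3)"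
  "cubic 2 u = u $ 1 * (u $ 1 * u $ 3)" "cubic 3 u = u $ 1 * (u $ 1 * u $ 1)"
  "cubic 4 u = u $ 2 * (u $ 3 * u $ 3)" "cubic 5 u = u $ 1 * (u $ 2 * u $ 3)"
  "cubic 6 u = u $ 1 * (u $ 1 * u $ 2)" "cubic 8 u = u $ 2 * (u $ 2 * u $ 3)"
  "cubic 9 u = u $ 1 * (u $ 2 * u $ 2)" "cubic 12 u = u $ 2 * (u $ 2 * u $ 2)"
  by (simp_all add: cubic_def power2_eq_square power3_eq_cube)

lemma cubic_weight3: "cubic (weight3 (i, j, k)) u = u $ i * u $ j * u $ k"
proof -
  have "i \<in> {1, 2, 3}" "j \<in> {1, 2, 3}" "k \<in> {1, 2, 3}"
    using exhaust_3[of i] exhaust_3[of j] exhaust_3[of k] by blast+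
  then show ?thesis
    by (elim insertE emptyE) (simp_all add: weight3_def cubic_simps mult_ac
        cubic_simps(2-4)[unfolded One_nat_def numeral_2_eq_2 numeral_3_eq_3])
qed

lemma range_weight3: "range weight3 = {0, 1, 2, 3, 4, 5, 6, 8, 9, 12}" (is "_ = ?S")
proof
  have "weight3 (i, j, k) \<in> ?S" for i j k
  proof -
    have "weight i = 0 \<or> weight i = 1 \<or> weight i = 4" for i by (simp add: weight_def)
    from this[of i] this[of j] this[of k] show ?thesis by (auto simp only: weight3_def) simp_all
  qed
  then show "range weight3 \<subseteq> ?S" by (metis image_subsetI prod_cases3)
  have "{weight3 (3, 3, 3), weight3 (3, 3, 1), weight3 (3, 1, 1), weight3 (1, 1, 1),
      weight3 (3, 3, 2), weight3 (3, 1, 2), weight3 (1, 1, 2), weight3 (3, 2, 2),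
      weight3 (1, 2, 2), weight3 (2, 2, 2)} \<subseteq> range weight3" by blast
  moreover have "weight3 (3, 3, 3) = 0" "weight3 (3, 3, 1) = 1" "weight3 (3, 1, 1) = 2"
    "weight3 (1, 1, 1) = 3" "weight3 (3, 3, 2) = 4" "weight3 (3, 1, 2) = 5" "weight3 (1, 1, 2) = 6"
    "weight3 (3, 2, 2) = 8" "weight3 (1, 2, 2) = 9" "weight3 (2, 2, 2) = 12"
    by (simp_all add: weight3_def)
  ultimately show "?S \<subseteq> range weight3" by (simp only:)
qed

lemma independent_cubics:
  assumes "\<And>u. (\<Sum>\<alpha>\<in>range weight3. c \<alpha> * cubic \<alpha> u) = 0" "\<alpha> \<in> range weight3"
  shows "c \<alpha> = 0"
proof -
  \<comment> \<open>Extended by zero to all exponents up to 12, the largest weight, \<open>c\<close>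
    becomes the coefficient sequence of a univariate polynomial that vanishes everywhere.\<close>
  let ?c = "\<lambda>n. if n \<in> range weight3 then c n else 0"
  have le: "range weight3 \<subseteq> {..12}" unfolding range_weight3 by auto
  have "(\<Sum>n\<le>12. ?c n * t ^ n) = 0" for t
  proof -
    let ?u = "(\<chi> i. t ^ weight i) :: complex ^ 3"
    have "cubic \<beta> ?u = t ^ \<beta>" for \<beta>
      by (simp add: cubic_def flip: power_mult power_add)
    then have "(\<Sum>n\<in>range weight3. c n * t ^ n) = 0" using assms(1)[of ?u] by simp
    also have "(\<Sum>n\<in>range weight3. c n * t ^ n) = (\<Sum>n\<le>12. ?c n * t ^ n)"
      using le by (intro sum.mono_neutral_cong_left) auto
    finally show ?thesis .
  qed
  then have "?c \<alpha> = 0" using polyfun_eq_0[where c = ?c and n = 12] assms(2) le by blast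
  then show ?thesis using assms(2) by simp
qed

section \<open>The monomial basis of the sections and the matching tensors\<close>

definition monomial_311 :: "nat \<times> 2 \<times> 2 \<Rightarrow> complex ^ 3 \<Rightarrow> complex ^ 2 \<Rightarrow> complex ^ 2 \<Rightarrow> complex" where
  "monomial_311 p u v w = (case p of (\<alpha>, l, m) \<Rightarrow> cubic \<alpha> u * v $ l * w $ m)"

definition monomials_311 :: "(nat \<times> 2 \<times> 2) set" where
  "monomials_311 = range weight3 \<times> UNIV"

text \<open>This is the coefficient of the monomial \<open>p\<close> in u \<otimes> (u \<otimes> v)
  \<otimes> (u \<otimes> w): its ones mark the entries equal to that monomial.\<close>

definition monomial_tensor :: "nat \<times> 2 \<times> 2 \<Rightarrow> complex ^ (3 \<times> (3 \<times> 2) \<times> (3 \<times> 2))" where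
  "monomial_tensor p =
    (\<chi> q. case q of (i, (j, l), (k, m)) \<Rightarrow> if p = (weight3 (i, j, k), l, m) then 1 else 0)"

lemma finite_monomials_311 [simp]: "finite monomials_311"
  by (simp add: monomials_311_def)

lemma card_monomials_311: "card monomials_311 = 40"
proof -
  have "card monomials_311 = card (range weight3) * card (UNIV :: (2 \<times> 2) set)"
    by (simp only: monomials_311_def card_cartesian_product)
  then show ?thesis unfolding range_weight3 by simp
qed

lemma monomial_in_sections:
  assumes "p \<in> monomials_311"
  shows "monomial_311 p \<in> sections_3_1_1"
proof -
  obtain i0 j0 k0 l0 m0 where p: "p = (weight3 (i0, j0, k0), l0, m0)"
    using assms by (auto simp: monomials_311_def)
  \<comment> \<open>Several ordered triples may give the same cubic monomial; the coefficient 1 is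
    put on a single one of them.\<close>
  define c :: "3 \<Rightarrow> 3 \<Rightarrow> 3 \<Rightarrow> 2 \<Rightarrow> 2 \<Rightarrow> complex" where
    "c i j k l m = (if m = m0 then if l = l0 then if k = k0 then if j = j0 then if i = i0
      then 1 else 0 else 0 else 0 else 0 else 0)" for i j k l m
  have "monomial_311 p = (\<lambda>u v w. \<Sum>i\<in>UNIV. \<Sum>j\<in>UNIV. \<Sum>k\<in>UNIV. \<Sum>l\<in>UNIV. \<Sum>m\<in>UNIV.
        c i j k l m * (u $ i * u $ j * u $ k) * v $ l * w $ m)"
    by (intro ext)
      (simp add: c_def monomial_311_def p cubic_weight3 if_distrib[of "\<lambda>x. x * _"] cong: if_cong)
  then show ?thesis unfolding sections_3_1_1_def by blast
qed

text \<open>Ordered triples of equal weight give the same cubic monomial, so their coefficients are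
  added up.\<close>

lemma section_expansion:
  assumes "f \<in> sections_3_1_1"
  shows "\<exists>c. f = (\<lambda>u v w. \<Sum>p\<in>monomials_311. c p * monomial_311 p u v w)"
proof -
  obtain c where f: "f = (\<lambda>u v w. \<Sum>i\<in>UNIV. \<Sum>j\<in>UNIV. \<Sum>k\<in>UNIV. \<Sum>l\<in>UNIV. \<Sum>m\<in>UNIV.
        c i j k l m * (u $ i * u $ j * u $ k) * v $ l * w $ m)"
    using assms unfolding sections_3_1_1_def by blast
  define C :: "3 \<times> 3 \<times> 3 \<Rightarrow> 2 \<Rightarrow> 2 \<Rightarrow> complex" where
    "C = (\<lambda>(i, j, k) l m. c i j k l m)"
  define D :: "nat \<times> 2 \<times> 2 \<Rightarrow> complex" where
    "D = (\<lambda>(\<alpha>, l, m). \<Sum>q | weight3 q = \<alpha>. C q l m)"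
  have "f u v w = (\<Sum>p\<in>monomials_311. D p * monomial_311 p u v w)" for u v w
  proof -
    have triple: "(\<Sum>i\<in>UNIV. \<Sum>j\<in>UNIV. \<Sum>k\<in>UNIV. F (i, j, k)) = sum F UNIV"
      for F :: "3 \<times> 3 \<times> 3 \<Rightarrow> complex"
      by (simp add: sum.cartesian_product split_def)
    have pair: "(\<Sum>l\<in>UNIV. \<Sum>m\<in>UNIV. c i j k l m * (u $ i * u $ j * u $ k) * v $ l * w $ m) =
        (\<Sum>r\<in>UNIV. C (i, j, k) (fst r) (snd r) * monomial_311 (weight3 (i, j, k), r) u v w)" for i j k
      by (simp add: C_def monomial_311_def cubic_weight3 sum.cartesian_product split_def mult_ac)
    have "f u v w = (\<Sum>q\<in>UNIV. \<Sum>r\<in>UNIV. C q (fst r) (snd r) * monomial_311 (weight3 q, r) u v w)"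
      unfolding f pair by (rule triple)
    also have "\<dots> = (\<Sum>\<alpha>\<in>range weight3. \<Sum>q | weight3 q = \<alpha>.
        \<Sum>r\<in>UNIV. C q (fst r) (snd r) * monomial_311 (\<alpha>, r) u v w)"
      by (subst sum.image_gen[where g = weight3]) (auto intro!: sum.cong)
    also have "\<dots> = (\<Sum>\<alpha>\<in>range weight3. \<Sum>r\<in>UNIV. D (\<alpha>, r) * monomial_311 (\<alpha>, r) u v w)"
    proof (rule sum.cong[OF refl])
      fix \<alpha>
      show "(\<Sum>q | weight3 q = \<alpha>. \<Sum>r\<in>UNIV. C q (fst r) (snd r) * monomial_311 (\<alpha>, r) u v w) =
        (\<Sum>r\<in>UNIV. D (\<alpha>, r) * monomial_311 (\<alpha>, r) u v w)"
        by (subst sum.swap) (simp add: D_def split_def sum_distrib_right)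
    qed
    also have "\<dots> = (\<Sum>p\<in>monomials_311. D p * monomial_311 p u v w)"
      by (simp add: sum.cartesian_product monomials_311_def split_def)
    finally show ?thesis .
  qed
  then show ?thesis by blast
qed

text \<open>Evaluation at unit vectors \<open>v\<close> and \<open>w\<close> singles out one pair of
  indices \<open>l\<close>, \<open>m\<close> and leaves a relation among the cubics.\<close>

lemma independent_monomials_311:
  assumes zero: "\<And>u v w. (\<Sum>p\<in>monomials_311. c p * monomial_311 p u v w) = 0"
    and p: "p \<in> monomials_311"
  shows "c p = 0"
proof -
  obtain \<alpha> l m where [simp]: "p = (\<alpha>, l, m)" and \<alpha>: "\<alpha> \<in> range weight3"
    using p by (auto simp: monomials_311_def)
  have "(\<Sum>\<beta>\<in>range weight3. c (\<beta>, l, m) * cubic \<beta> u) = 0" for u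
  proof -
    have coord: "monomial_311 (\<beta>, r) u (axis l 1) (axis m 1) = (if r = (l, m) then cubic \<beta> u else 0)"
      for \<beta> r
      by (cases r) (simp add: monomial_311_def axis_def)
    have "(\<Sum>\<beta>\<in>range weight3. \<Sum>r\<in>UNIV.
        c (\<beta>, r) * monomial_311 (\<beta>, r) u (axis l 1) (axis m 1)) = 0"
      using zero[of u "axis l 1" "axis m 1"]
      by (simp add: monomials_311_def sum.cartesian_product split_def)
    then show ?thesis
      by (simp add: coord if_distrib[of "(*) _"] cong: if_cong)
  qed
  from independent_cubics[OF this \<alpha>] show ?thesis by simp
qed

text \<open>Every entry of the right-hand side is exactly one of the 40 monomials. The monomials
  thus serve as the coordinates of this tensor on fixed vectors.\<close>

lemma monomial_tensor_expansion:
  "(\<Sum>p\<in>monomials_311. monomial_311 p u v w *s monomial_tensor p) =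
    tensor3 u (tensor2 u v) (tensor2 u w)"
proof -
  have "(\<Sum>p\<in>monomials_311. monomial_311 p u v w * monomial_tensor p $ (i, (j, l), (k, m))) =
      u $ i * (u $ j * v $ l) * (u $ k * w $ m)" for i j l k m
  proof -
    have "(weight3 (i, j, k), l, m) \<in> monomials_311" by (simp add: monomials_311_def)
    then show ?thesis
      by (simp add: monomial_tensor_def if_distrib[of "(*) _"] cong: if_cong)
        (simp add: monomial_311_def cubic_weight3)
  qed
  note coord = this
  show ?thesis
  proof (rule vec_eq_iff[THEN iffD2, OF allI])
    fix q :: "3 \<times> (3 \<times> 2) \<times> (3 \<times> 2)"
    obtain i j l k m where q: "q = (i, (j, l), (k, m))" by (metis surj_pair)
    show "(\<Sum>p\<in>monomials_311. monomial_311 p u v w *s monomial_tensor p) $ q =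
        tensor3 u (tensor2 u v) (tensor2 u w) $ q"
      by (simp only: q sum_component vector_smult_component coord tensor3_nth tensor2_nth fst_conv snd_conv)
  qed
qed

text \<open>The supports of the monomial tensors are disjoint and nonempty, so one entry isolates
  one coefficient.\<close>

lemma independent_monomial_tensors:
  assumes "(\<Sum>p\<in>monomials_311. c p *s monomial_tensor p) = 0" "p \<in> monomials_311"
  shows "c p = 0"
proof -
  obtain i j k l m where p: "p = (weight3 (i, j, k), l, m)"
    using assms(2) by (auto simp: monomials_311_def)
  have "0 = (\<Sum>q\<in>monomials_311. c q * monomial_tensor q $ (i, (j, l), (k, m)))"
    using arg_cong[OF assms(1), of "\<lambda>t. t $ (i, (j, l), (k, m))"] by simp
  also have "\<dots> = c p"
    using assms(2) by (simp add: monomial_tensor_def p if_distrib[of "(*) _"] cong: if_cong)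
  finally show ?thesis by simp
qed

text \<open>Equal members at two different indices would give a relation with coefficients 1 and -1,
  so the absence of nontrivial relations over the index type also yields injectivity.\<close>

lemma independent_family:
  fixes b :: "'m::finite \<Rightarrow> complex ^ 'n"
  assumes indep: "\<And>c m. (\<Sum>m\<in>UNIV. c m *s b m) = 0 \<Longrightarrow> c m = 0"
  shows "inj b \<and> vec.independent (range b)"
proof
  show inj: "inj b"
  proof (rule injI, rule ccontr)
    fix m n assume "b m = b n" "m \<noteq> n"
    have "(\<Sum>k\<in>UNIV. ((if k = m then 1 else 0) - (if k = n then 1 else 0)) *s b k) =
      (\<Sum>k\<in>UNIV. if k = m then b k else 0) - (\<Sum>k\<in>UNIV. if k = n then b k else 0)"
      unfolding sum_subtractf[symmetric] by (intro sum.cong) auto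
    also have "\<dots> = 0" using \<open>b m = b n\<close> by simp
    finally have "(if m = m then 1 else 0) - (if m = n then 1 else 0) = (0 :: complex)"
      by (rule indep)
    then show False using \<open>m \<noteq> n\<close> by simp
  qed
  have "c (b m) = 0" if "(\<Sum>v\<in>range b. c v *s v) = 0" for c m
    using indep[of "c \<circ> b"] that by (simp add: sum.reindex[OF inj])
  then show "vec.independent (range b)"
    by (auto simp: vec.dependent_finite)
qed

section \<open>The fourfold attached to two injective matrices\<close>

definition fourfold_map ::
  "complex ^ (3 \<times> 2) ^ 'y \<Rightarrow> complex ^ (3 \<times> 2) ^ 'z \<Rightarrow>
    (complex ^ 3) set \<times> (complex ^ 2) set \<times> (complex ^ 2) set \<Rightarrow>
    (complex ^ (3 \<times> 'y::finite \<times> 'z::finite)) set" where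
  "fourfold_map M N = (\<lambda>(P, Q, R). vec.span
    {tensor3 u (M *v tensor2 u v) (N *v tensor2 u w) | u v w. u \<in> P \<and> v \<in> Q \<and> w \<in> R})"

text \<open>The span in \<open>fourfold_map\<close> runs over all vectors of the three lines, which
  avoids a choice of representatives. By multihomogeneity they all yield multiples of one
  tensor.\<close>

lemma fourfold_map_proj_pt:
  "fourfold_map M N (proj_pt u, proj_pt v, proj_pt w) =
    proj_pt (tensor3 u (M *v tensor2 u v) (N *v tensor2 u w))"
proof -
  let ?t = "tensor3 u (M *v tensor2 u v) (N *v tensor2 u w)"
  let ?S = "{tensor3 u' (M *v tensor2 u' v') (N *v tensor2 u' w') | u' v' w'.
    u' \<in> proj_pt u \<and> v' \<in> proj_pt v \<and> w' \<in> proj_pt w}"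
  have "?t \<in> ?S" using vec.span_base[of u "{u}"] vec.span_base[of v "{v}"] vec.span_base[of w "{w}"]
    unfolding proj_pt_def by blast
  moreover have "?S \<subseteq> vec.span {?t}"
    by (auto simp: proj_pt_def vec.span_singleton vector_scalar_commute)
  ultimately have "vec.span ?S = vec.span {?t}"
    by (intro vec.span_eq[THEN iffD2] conjI) (auto intro: vec.span_base)
  then show ?thesis by (simp add: fourfold_map_def proj_pt_def)
qed

lemma matrix_tensor2_eq_0_iff:
  "inj ((*v) M) \<Longrightarrow> M *v tensor2 u v = 0 \<longleftrightarrow> u = 0 \<or> v = 0"
  by (metis injD matrix_vector_mult_0_right tensor2_eq_0_iff)

text \<open>The Segre embedding separates the three factors; cancelling \<open>M\<close> and
  \<open>N\<close> leaves u \<otimes> v and u \<otimes> w up to scalars, which determine the points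
  of \<open>v\<close> and \<open>w\<close>.\<close>

lemma inj_on_fourfold_map:
  assumes M: "inj ((*v) M)" and N: "inj ((*v) N)"
  shows "inj_on (fourfold_map M N) (proj_space \<times> proj_space \<times> proj_space)"
proof -
  have "proj_pt u = proj_pt u' \<and> proj_pt v = proj_pt v' \<and> proj_pt w = proj_pt w'"
    if eq: "proj_pt (tensor3 u (M *v tensor2 u v) (N *v tensor2 u w)) =
        proj_pt (tensor3 u' (M *v tensor2 u' v') (N *v tensor2 u' w'))"
      and nz: "u \<noteq> 0" "v \<noteq> 0" "w \<noteq> 0" for u u' v v' w w'
  proof -
    have "M *v tensor2 u v \<noteq> 0" "N *v tensor2 u w \<noteq> 0"
      using nz by (simp_all add: matrix_tensor2_eq_0_iff M N)
    note * = proj_pt_tensor3_eqD[OF eq \<open>u \<noteq> 0\<close> this]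
    have nz2: "tensor2 u v \<noteq> 0" "tensor2 u w \<noteq> 0" using nz by (simp_all add: tensor2_eq_0_iff)
    show ?thesis
      using *(1) proj_pt_tensor2_eqD[OF proj_pt_matrix_eqD[OF *(2) M nz2(1)] nz(1,2)]
        proj_pt_tensor2_eqD[OF proj_pt_matrix_eqD[OF *(3) N nz2(2)] nz(1,3)] by blast
  qed
  note eqD = this
  show ?thesis
  proof (rule inj_onI)
    fix x y assume "x \<in> proj_space \<times> proj_space \<times> proj_space"
      "y \<in> proj_space \<times> proj_space \<times> proj_space" and eq: "fourfold_map M N x = fourfold_map M N y"
    then obtain u v w u' v' w' where
      x: "x = (proj_pt u, proj_pt v, proj_pt w)" and y: "y = (proj_pt u', proj_pt v', proj_pt w')"
      and nz: "u \<noteq> 0" "v \<noteq> 0" "w \<noteq> 0"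
      unfolding proj_space_def by blast
    from eq have "proj_pt (tensor3 u (M *v tensor2 u v) (N *v tensor2 u w)) =
        proj_pt (tensor3 u' (M *v tensor2 u' v') (N *v tensor2 u' w'))"
      unfolding x y fourfold_map_proj_pt .
    from eqD[OF this nz] show "x = y" by (simp add: x y)
  qed
qed

text \<open>The image point is \<open>tensor_map M N\<close> of u \<otimes> (u \<otimes> v)
  \<otimes> (u \<otimes> w), so its coordinates on the images of the monomial tensors are the 40
  monomials. Injectivity keeps these images independent, and their span is the subspace
  sought.\<close>

lemma embedding_fourfold_map:
  assumes M: "inj ((*v) M)" and N: "inj ((*v) N)"
  shows "\<exists>\<Lambda>. vec.subspace \<Lambda> \<and> vec.dim \<Lambda> = 40 \<and> embedding_by_3_1_1 \<Lambda> (fourfold_map M N)"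
proof -
  have "card (UNIV :: 40 set) = card monomials_311" by (simp add: card_monomials_311)
  then obtain h :: "40 \<Rightarrow> nat \<times> 2 \<times> 2" where h: "bij_betw h UNIV monomials_311"
    using finite_same_card_bij[of "UNIV :: 40 set" monomials_311] by auto
  define g where "g = inv h"
  have h_mem: "h m \<in> monomials_311" and gh: "g (h m) = m" for m
    using h by (auto simp: g_def bij_betw_def inv_f_f)
  have reindex: "(\<Sum>m\<in>UNIV. F (h m)) = sum F monomials_311" for F :: "_ \<Rightarrow> 'd::comm_monoid_add"
    by (rule sum.reindex_bij_betw[OF h])
  define b where "b m = tensor_map M N (monomial_tensor (h m))" for m
  define s where "s m = monomial_311 (h m)" for m
  have "c m = 0" if "(\<Sum>m\<in>UNIV. c m *s b m) = 0" for c m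
  proof -
    have "tensor_map M N (\<Sum>m\<in>UNIV. c m *s monomial_tensor (h m)) = 0"
      using that by (simp add: tensor_map_sum_scale b_def)
    \<comment> \<open>The instance for the empty sum says that the linear map sends 0 to 0.\<close>
    also have "\<dots> = tensor_map M N 0"
      using tensor_map_sum_scale[of M N _ _ "{}"] by simp
    finally have "(\<Sum>m\<in>UNIV. c m *s monomial_tensor (h m)) = 0"
      by (rule injD[OF inj_tensor_map[OF M N]])
    then have "(\<Sum>p\<in>monomials_311. c (g p) *s monomial_tensor p) = 0"
      using reindex[of "\<lambda>p. c (g p) *s monomial_tensor p"] by (simp add: gh)
    from independent_monomial_tensors[OF this h_mem[of m]] show ?thesis by (simp add: gh)
  qed
  then have b: "inj b" "vec.independent (range b)" using independent_family[of b] by auto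
  have sum_s: "(\<Sum>m\<in>UNIV. d (h m) * s m u v w) = (\<Sum>p\<in>monomials_311. d p * monomial_311 p u v w)"
    for d u v w
    unfolding s_def by (rule reindex)
  have "section_basis s"
    unfolding section_basis_def
  proof (intro conjI allI ballI ex_ex1I)
    show "s m \<in> sections_3_1_1" for m by (simp add: s_def monomial_in_sections h_mem)
  next
    fix f assume "f \<in> sections_3_1_1"
    then obtain c where "f = (\<lambda>u v w. \<Sum>p\<in>monomials_311. c p * monomial_311 p u v w)"
      using section_expansion by blast
    then have "f = (\<lambda>u v w. \<Sum>m\<in>UNIV. c (h m) * s m u v w)" by (simp only: sum_s[of c])
    then show "\<exists>c. f = (\<lambda>u v w. \<Sum>m\<in>UNIV. c m * s m u v w)"
      by (rule exI[of _ "\<lambda>m. c (h m)"])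
  next
    fix f c c'
    assume "f = (\<lambda>u v w. \<Sum>m\<in>UNIV. c m * s m u v w)" "f = (\<lambda>u v w. \<Sum>m\<in>UNIV. c' m * s m u v w)"
    then have "(\<Sum>m\<in>UNIV. c m * s m u v w) = (\<Sum>m\<in>UNIV. c' m * s m u v w)" for u v w
      by (metis (no_types))
    then have "(\<Sum>m\<in>UNIV. (c m - c' m) * s m u v w) = 0" for u v w
      by (simp add: left_diff_distrib sum_subtractf)
    then have "(\<Sum>p\<in>monomials_311. (c (g p) - c' (g p)) * monomial_311 p u v w) = 0" for u v w
      using sum_s[of "\<lambda>p. c (g p) - c' (g p)" u v w] by (simp only: gh)
    from independent_monomials_311[OF this h_mem] show "c = c'" by (auto simp: gh fun_eq_iff)
  qed
  moreover have "fourfold_map M N (proj_pt u, proj_pt v, proj_pt w) =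
      proj_pt (\<Sum>m\<in>UNIV. s m u v w *s b m)" for u v w
    using reindex[of "\<lambda>p. monomial_311 p u v w *s monomial_tensor p"]
    by (simp add: fourfold_map_proj_pt s_def b_def monomial_tensor_expansion tensor_map_tensor3
        flip: tensor_map_sum_scale)
  ultimately have "embedding_by_3_1_1 (vec.span (range b)) (fourfold_map M N)"
    unfolding embedding_by_3_1_1_def using b inj_on_fourfold_map[OF M N] by blast
  moreover have "vec.dim (vec.span (range b)) = 40"
    using vec.dim_eq_card_independent[OF b(2)] by (simp add: card_image[OF b(1)])
  ultimately show ?thesis using vec.subspace_span by blast
qed

lemma fourfold_subset_segre:
  assumes M: "inj ((*v) M)" and N: "inj ((*v) N)"
  shows "fourfold_map M N ` (proj_space \<times> proj_space \<times> proj_space) \<subseteq> segre_variety"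
  unfolding segre_variety_def proj_space_def
  by (force simp: fourfold_map_proj_pt matrix_tensor2_eq_0_iff M N)

section \<open>Segre embeddings through given points\<close>

lemma matrix_mult_axis: "A *v axis i (1 :: complex) = column i A"
  by (simp add: matrix_vector_mult_def axis_def column_def if_distrib cong: if_cong)

definition subst_col :: "complex ^ 'n ^ 'n \<Rightarrow> complex ^ 'n \<Rightarrow> 'n \<Rightarrow> complex ^ 'n ^ 'n" where
  "subst_col A w i = (\<chi> r c. if c = i then w $ r else A $ r $ c)"

text \<open>Cramer's rule multiplied by the determinant: the solution vector is polynomial in the
  entries of \<open>A\<close> and \<open>w\<close>.\<close>

lemma mult_cramer:
  assumes "det A \<noteq> 0"
  shows "A *v (\<chi> i. det (subst_col A w i)) = det A *s w"
proof -
  have "A *v (\<chi> i. det (subst_col A w i) / det A) = w"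
    using cramer[OF assms, of "\<chi> i. det (subst_col A w i) / det A" w]
    by (simp add: subst_col_def)
  moreover have "(\<chi> i. det (subst_col A w i)) = det A *s (\<chi> i. det (subst_col A w i) / det A)"
    using assms by (simp add: vec_eq_iff)
  ultimately show ?thesis by (simp add: matrix_vector_mult_scaleR vector_scalar_commute)
qed

lemma det_subst_col_id: "det (subst_col (mat 1) w i) = w $ i"
  using mult_cramer[of "mat 1" w] by (simp add: vec_eq_iff)

text \<open>The points are labelled by \<open>\<iota>\<close> (points whose \<open>b\<close> form a basis) and \<open>\<kappa>\<close> (the extra points).
  Up to the factor \<open>det (base_matrix \<iota> b)\<close>, \<open>extra_coeff\<close> lists the coordinates of \<open>b (\<kappa> s)\<close> in the basis
  \<open>b \<circ> \<iota>\<close>; up to the factor \<open>det (relation_matrix a b)\<close>, \<open>fibre_coord\<close> is the solution \<open>p\<close> of the linear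
  system with \<open>v (\<kappa> s) = axis s 1\<close>. Omitting the denominators keeps everything polynomial.\<close>

definition base_matrix :: "('i \<Rightarrow> 'k) \<Rightarrow> ('k \<Rightarrow> complex ^ 'i) \<Rightarrow> complex ^ 'i ^ 'i" where
  "base_matrix \<iota> b = (\<chi> r c. b (\<iota> c) $ r)"

definition extra_coeff ::
  "('i \<Rightarrow> 'k) \<Rightarrow> ('s \<Rightarrow> 'k) \<Rightarrow> ('k \<Rightarrow> complex ^ 'i) \<Rightarrow> 's \<Rightarrow> 'i \<Rightarrow> complex" where
  "extra_coeff \<iota> \<kappa> b s i = det (subst_col (base_matrix \<iota> b) (b (\<kappa> s)) i)"

context
  fixes \<iota> :: "'j::finite \<times> 's::finite \<Rightarrow> 'k" and \<kappa> :: "'s \<Rightarrow> 'k"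
begin

text \<open>Row \<open>(j, s)\<close> is the \<open>j\<close>-th coordinate of the vector equation
  coming from the relation that expresses \<open>b (\<kappa> s)\<close> through the basis
  \<open>b \<circ> \<iota>\<close>. The unknowns are the values of \<open>p\<close> at the points
  labelled by \<iota>; the values at \<kappa> belong to the right-hand side.\<close>

definition relation_matrix ::
  "('k \<Rightarrow> complex ^ 'j) \<Rightarrow> ('k \<Rightarrow> complex ^ ('j \<times> 's)) \<Rightarrow> complex ^ ('j \<times> 's) ^ ('j \<times> 's)" where
  "relation_matrix a b = (\<chi> r c. extra_coeff \<iota> \<kappa> b (snd r) c * a (\<iota> c) $ fst r)"

definition fibre_coord ::
  "('k \<Rightarrow> complex ^ 'j) \<Rightarrow> ('k \<Rightarrow> complex ^ ('j \<times> 's)) \<Rightarrow> 's \<Rightarrow> 'j \<times> 's \<Rightarrow> complex" where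
  "fibre_coord a b s i = det (subst_col (relation_matrix a b) (tensor2 (a (\<kappa> s)) (axis s 1)) i)"

text \<open>Column \<open>c\<close> is the tensor of \<open>a (\<iota> c)\<close> with the vector
  whose coordinates are the values of the solutions at \<open>c\<close>. A nonzero determinant says
  that these tensors form a basis.\<close>

definition segre_matrix ::
  "('k \<Rightarrow> complex ^ 'j) \<Rightarrow> ('k \<Rightarrow> complex ^ ('j \<times> 's)) \<Rightarrow> complex ^ ('j \<times> 's) ^ ('j \<times> 's)" where
  "segre_matrix a b = (\<chi> r c. a (\<iota> c) $ fst r * fibre_coord a b (snd r) c)"

definition discriminant :: "('k \<Rightarrow> complex ^ 'j) \<Rightarrow> ('k \<Rightarrow> complex ^ ('j \<times> 's)) \<Rightarrow> complex" where
  "discriminant a b =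
    det (base_matrix \<iota> b) * det (relation_matrix a b) * det (segre_matrix a b)"

text \<open>The matrix \<open>M\<close> is determined by sending the columns of
  \<open>segre_matrix\<close> to the basis \<open>b \<circ> \<iota>\<close>. The linear system says
  that the coefficients expressing \<open>b (\<kappa> s)\<close> in this basis also express the
  tensor at \<open>\<kappa> s\<close> in those columns, up to determinants, so the extra points are
  hit as well.\<close>

lemma segre_through_points:
  assumes disc: "discriminant a b \<noteq> 0" and cover: "range \<iota> \<union> range \<kappa> = UNIV"
  shows "\<exists>M :: complex ^ ('j \<times> 's) ^ ('j \<times> 's). inj ((*v) M) \<and>
    (\<forall>k. \<exists>v c. v \<noteq> 0 \<and> c \<noteq> 0 \<and> M *v tensor2 (a k) v = c *s b k)"
proof -
  let ?B = "base_matrix \<iota> b" and ?N = "relation_matrix a b" and ?D = "segre_matrix a b"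
  let ?\<beta> = "extra_coeff \<iota> \<kappa> b" and ?q = "fibre_coord a b"
  have dets: "det ?B \<noteq> 0" "det ?N \<noteq> 0" "det ?D \<noteq> 0"
    using disc by (auto simp: discriminant_def)
  then have "invertible ?B" "invertible ?D" by (simp_all add: invertible_det_nz)
  then obtain D' where D': "D' ** ?D = mat 1" "?D ** D' = mat 1" by (auto simp: invertible_def)
  have injB: "inj ((*v) ?B)"
    using \<open>invertible ?B\<close> by (metis invertible_left_inverse matrix_left_invertible_injective)
  define M where "M = ?B ** D'"
  have "inj ((*v) D')"
    using D' matrix_left_invertible_injective by blast
  then have injM: "inj ((*v) M)"
    using inj_compose[OF injB \<open>inj ((*v) D')\<close>] by (simp add: M_def o_def matrix_vector_mul_assoc)
  have MD: "M *v (?D *v x) = ?B *v x" for x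
    using D' by (simp add: M_def matrix_vector_mul_assoc flip: matrix_mul_assoc)
  have nz: "v \<noteq> 0" if "M *v tensor2 u v = c *s (?B *v x)" "c \<noteq> 0" "x \<noteq> 0" for u v c x
  proof
    assume "v = 0"
    then have "tensor2 u v = 0" by (simp add: vec_eq_iff)
    then have "?B *v x = ?B *v 0" using that by simp
    then show False using injD[OF injB] \<open>x \<noteq> 0\<close> by blast
  qed
  have "\<exists>v c. v \<noteq> 0 \<and> c \<noteq> 0 \<and> M *v tensor2 (a (\<iota> i)) v = c *s b (\<iota> i)" for i
  proof -
    have B: "?B *v axis i 1 = b (\<iota> i)"
      by (simp add: vec_eq_iff matrix_mult_axis column_def base_matrix_def)
    have "?D *v axis i 1 = tensor2 (a (\<iota> i)) (\<chi> s. ?q s i)"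
      by (simp add: vec_eq_iff matrix_mult_axis column_def segre_matrix_def)
    then have "M *v tensor2 (a (\<iota> i)) (\<chi> s. ?q s i) = 1 *s (?B *v axis i 1)"
      using MD[of "axis i 1"] by simp
    moreover from this have "(\<chi> s. ?q s i) \<noteq> 0" by (rule nz) simp_all
    ultimately show ?thesis unfolding B using zero_neq_one by metis
  qed
  moreover have "\<exists>v c. v \<noteq> 0 \<and> c \<noteq> 0 \<and> M *v tensor2 (a (\<kappa> s)) v = c *s b (\<kappa> s)" for s
  proof -
    have B: "?B *v (\<chi> i. ?\<beta> s i) = det ?B *s b (\<kappa> s)"
      unfolding extra_coeff_def by (rule mult_cramer) (rule dets)
    have N: "?N *v (\<chi> i. ?q t i) = det ?N *s tensor2 (a (\<kappa> t)) (axis t 1)" for t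
      unfolding fibre_coord_def by (rule mult_cramer) (rule dets)
    \<comment> \<open>Regrouping the products, row \<open>r\<close> of this equation is row
      \<open>(fst r, s)\<close> of the linear system, applied to the solution with index
      \<open>snd r\<close>.\<close>
    have "(?D *v (\<chi> i. ?\<beta> s i)) $ r = (det ?N *s tensor2 (a (\<kappa> s)) (axis s 1)) $ r" for r
    proof -
      have "(?D *v (\<chi> i. ?\<beta> s i)) $ r = (?N *v (\<chi> i. ?q (snd r) i)) $ (fst r, s)"
        by (simp add: matrix_vector_mult_def segre_matrix_def relation_matrix_def mult_ac)
      also have "\<dots> = (det ?N *s tensor2 (a (\<kappa> s)) (axis s 1)) $ r"
        by (auto simp: N axis_def)
      finally show ?thesis .
    qed
    then have "?D *v (\<chi> i. ?\<beta> s i) = det ?N *s tensor2 (a (\<kappa> s)) (axis s 1)"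
      by (simp add: vec_eq_iff)
    then have "det ?N *s (M *v tensor2 (a (\<kappa> s)) (axis s 1)) = det ?B *s b (\<kappa> s)"
      using MD[of "\<chi> i. ?\<beta> s i"] B by (simp add: vector_scalar_commute)
    then have "M *v tensor2 (a (\<kappa> s)) (axis s 1) = (det ?B / det ?N) *s b (\<kappa> s)"
      using dets by (simp add: vec_eq_iff field_simps)
    moreover have "axis s (1::complex) \<noteq> 0" by simp
    moreover have "det ?B / det ?N \<noteq> 0" using dets by simp
    ultimately show ?thesis by blast
  qed
  ultimately have "\<exists>v c. v \<noteq> 0 \<and> c \<noteq> 0 \<and> M *v tensor2 (a k) v = c *s b k" for k
    using cover by (metis UNIV_I UnE imageE)
  with injM show ?thesis by (intro exI[of _ M] conjI allI)
qed

text \<open>Here \<open>1\<close> is the all-ones vector. The coefficients of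
  \<open>b (\<kappa> s)\<close> are the indicator of second index \<open>s\<close>, which turns each
  of the three matrices into the identity.\<close>

lemma discriminant_eq_1:
  assumes "\<And>j s. a (\<iota> (j, s)) = axis j 1" "\<And>s. a (\<kappa> s) = 1"
    and "\<And>i. b (\<iota> i) = axis i 1" "\<And>s. b (\<kappa> s) = tensor2 1 (axis s 1)"
  shows "discriminant a b = 1"
proof -
  have B: "base_matrix \<iota> b = mat 1"
    by (auto simp: base_matrix_def vec_eq_iff mat_def assms axis_def)
  then have "extra_coeff \<iota> \<kappa> b s i = tensor2 1 (axis s 1) $ i" for s i
    by (simp only: extra_coeff_def det_subst_col_id assms)
  then have N: "relation_matrix a b = mat 1"
    by (auto simp: relation_matrix_def vec_eq_iff mat_def assms axis_def)
  then have "fibre_coord a b s i = tensor2 1 (axis s 1) $ i" for s i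
    by (simp only: fibre_coord_def det_subst_col_id assms)
  then have "segre_matrix a b = mat 1"
    by (auto simp: segre_matrix_def vec_eq_iff mat_def assms axis_def)
  then show ?thesis by (simp add: discriminant_def B N)
qed

end

section \<open>Multihomogeneous forms\<close>

abbreviation unit_deg :: "'k \<Rightarrow> 'k \<Rightarrow> nat" where
  "unit_deg i \<equiv> \<lambda>i'. if i' = i then 1 else 0"

lemma multiform_prod:
  assumes "finite S" "\<And>i. i \<in> S \<Longrightarrow> multiform (d i) (f i)"
  shows "multiform (\<lambda>k. \<Sum>i\<in>S. d i k) (\<lambda>x. \<Prod>i\<in>S. f i x)"
  using assms
proof (induction S rule: finite_induct)
  case empty
  then show ?case using multiform.const[of 1] by simp
next
  case (insert i S)
  then show ?case using multiform.mult[of "d i" "f i"] by simp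
qed

lemma multiform_power:
  assumes "multiform d f"
  shows "multiform (\<lambda>k. n * d k) (\<lambda>x. f x ^ n)"
  using multiform_prod[of "{..<n}" "\<lambda>_. d" "\<lambda>_. f"] assms by simp

text \<open>Zero is a form of every multidegree, as 0 times a monomial of that degree; this allows
  vanishing summands and entries in a form of prescribed degree.\<close>

lemma multiform_zero: "multiform d (\<lambda>_ :: 'k::finite \<Rightarrow> complex ^ 'n. 0)"
proof -
  have "multiform (\<lambda>k. \<Sum>i\<in>UNIV. d i * unit_deg i k)
      (\<lambda>x :: 'k \<Rightarrow> complex ^ 'n. \<Prod>i\<in>UNIV. (x i $ undefined) ^ d i)"
    by (intro multiform_prod multiform_power multiform.coord) auto
  moreover have "(\<lambda>k. \<Sum>i\<in>UNIV. d i * unit_deg i k) = d" by (auto simp: sum.delta' if_distrib cong: if_cong)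
  ultimately show ?thesis using multiform.mult[OF multiform.const[of 0]] by fastforce
qed

lemma multiform_sum:
  fixes f :: "'i \<Rightarrow> ('k::finite \<Rightarrow> complex ^ 'n) \<Rightarrow> complex"
  assumes "\<And>i. i \<in> S \<Longrightarrow> multiform d (f i)"
  shows "multiform d (\<lambda>x. \<Sum>i\<in>S. f i x)"
  using assms
  by (induction S rule: infinite_finite_induct) (auto intro: multiform_zero multiform.add)

text \<open>If entry degrees split into a row part and a column part, all Leibniz terms have the
  same multidegree, since a permutation only reorders the column parts.\<close>

lemma multiform_det:
  fixes A :: "('k::finite \<Rightarrow> complex ^ 'n) \<Rightarrow> complex ^ 'm ^ 'm"
  assumes "\<And>i j. multiform (\<lambda>k. r i k + c j k) (\<lambda>x. A x $ i $ j)"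
  shows "multiform (\<lambda>k. (\<Sum>i\<in>UNIV. r i k) + (\<Sum>j\<in>UNIV. c j k)) (\<lambda>x. det (A x))"
  unfolding det_def
proof (rule multiform_sum)
  fix p :: "'m \<Rightarrow> 'm" assume "p \<in> {p. p permutes UNIV}"
  then have p: "bij p" by (simp add: permutes_bij)
  have "multiform (\<lambda>k. \<Sum>i\<in>UNIV. r i k + c (p i) k) (\<lambda>x. \<Prod>i\<in>UNIV. A x $ i $ p i)"
    by (intro multiform_prod assms) auto
  moreover have "(\<Sum>i\<in>UNIV. r i k + c (p i) k) = (\<Sum>i\<in>UNIV. r i k) + (\<Sum>j\<in>UNIV. c j k)" for k
    using sum.reindex_bij_betw[OF p, of "\<lambda>j. c j k"] by (simp add: sum.distrib)
  ultimately show "multiform (\<lambda>k. (\<Sum>i\<in>UNIV. r i k) + (\<Sum>j\<in>UNIV. c j k))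
      (\<lambda>x. of_int (sign p) * (\<Prod>i\<in>UNIV. A x $ i $ p i))"
    using multiform.mult[OF multiform.const[of "of_int (sign p)"]] by fastforce
qed

text \<open>In \<open>relation_matrix\<close>, the factor \<open>a (\<iota> c)\<close> restores the
  degree that \<open>extra_coeff\<close> loses by replacing column \<open>c\<close>. The entry
  degrees therefore depend on the row only, and \<open>multiform_det\<close> applies.\<close>

lemma multiform_discriminant:
  fixes a :: "('k::finite \<Rightarrow> complex ^ 'n) \<Rightarrow> 'k \<Rightarrow> complex ^ 'j"
    and b :: "('k \<Rightarrow> complex ^ 'n) \<Rightarrow> 'k \<Rightarrow> complex ^ ('j::finite \<times> 's::finite)"
    and \<iota> :: "'j \<times> 's \<Rightarrow> 'k" and \<kappa> :: "'s \<Rightarrow> 'k"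
  assumes a: "\<And>k j. multiform (unit_deg k) (\<lambda>x. a x k $ j)"
    and b: "\<And>k i. multiform (unit_deg k) (\<lambda>x. b x k $ i)"
  shows "\<exists>d. multiform d (\<lambda>x. discriminant \<iota> \<kappa> (a x) (b x))"
proof -
  \<comment> \<open>\<open>E\<close> is the degree of the base determinant, \<open>G i\<close> the
    part left after removing column \<open>i\<close>, and \<open>Q\<close> the degree of a fibre
    coordinate.\<close>
  define E :: "'k \<Rightarrow> nat" where "E k = (\<Sum>i\<in>UNIV. unit_deg (\<iota> i) k)" for k
  define G where "G i k = (\<Sum>i'\<in>UNIV - {i}. unit_deg (\<iota> i') k)" for i k
  define Q where "Q k = (\<Sum>r\<in>(UNIV :: ('j \<times> 's) set). unit_deg (\<kappa> (snd r)) k) + (CARD('j \<times> 's) - 1) * E k" for k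
  have E: "E k = unit_deg (\<iota> i) k + G i k" for i k
    unfolding E_def G_def by (rule sum.remove) auto
  have split: "(\<Sum>c\<in>UNIV. (if c = i then f k else g k c)) = f k + (\<Sum>c\<in>UNIV - {i}. g k c)"
    for i :: "'j \<times> 's" and f :: "'k \<Rightarrow> nat" and g :: "'k \<Rightarrow> 'j \<times> 's \<Rightarrow> nat" and k
    by (subst sum.remove[of _ i]) (auto intro!: sum.cong)
  have B: "multiform E (\<lambda>x. det (base_matrix \<iota> (b x)))"
    using multiform_det[of "\<lambda>_ _. 0" "\<lambda>i. unit_deg (\<iota> i)" "\<lambda>x. base_matrix \<iota> (b x)"] b
    by (simp add: base_matrix_def E_def[abs_def])
  have \<beta>: "multiform (\<lambda>k. unit_deg (\<kappa> s) k + G i k) (\<lambda>x. extra_coeff \<iota> \<kappa> (b x) s i)" for s i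
  proof -
    have "multiform (\<lambda>k. (\<Sum>r\<in>(UNIV :: ('j \<times> 's) set). 0) +
        (\<Sum>c\<in>UNIV. if c = i then unit_deg (\<kappa> s) k else unit_deg (\<iota> c) k))
        (\<lambda>x. det (subst_col (base_matrix \<iota> (b x)) (b x (\<kappa> s)) i))"
    proof (rule multiform_det)
      show "multiform (\<lambda>k. 0 + (if c = i then unit_deg (\<kappa> s) k else unit_deg (\<iota> c) k))
          (\<lambda>x. subst_col (base_matrix \<iota> (b x)) (b x (\<kappa> s)) i $ r $ c)" for r c
        by (cases "c = i") (simp_all add: subst_col_def base_matrix_def b)
    qed
    then show ?thesis by (subst (asm) split) (simp add: G_def extra_coeff_def)
  qed
  have N: "multiform (\<lambda>k. unit_deg (\<kappa> (snd r)) k + E k) (\<lambda>x. relation_matrix \<iota> \<kappa> (a x) (b x) $ r $ c)"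
    for r c
    using multiform.mult[OF \<beta>[of "snd r" c] a[of "\<iota> c" "fst r"]]
    by (simp add: relation_matrix_def E[of _ c] add_ac)
  have q: "multiform Q (\<lambda>x. fibre_coord \<iota> \<kappa> (a x) (b x) s i)" for s i
  proof -
    have "multiform (\<lambda>k. (\<Sum>r\<in>(UNIV :: ('j \<times> 's) set). unit_deg (\<kappa> (snd r)) k) +
        (\<Sum>c\<in>UNIV. if c = i then 0 else E k))
        (\<lambda>x. det (subst_col (relation_matrix \<iota> \<kappa> (a x) (b x)) (tensor2 (a x (\<kappa> s)) (axis s 1)) i))"
    proof (rule multiform_det)
      show "multiform (\<lambda>k. unit_deg (\<kappa> (snd r)) k + (if c = i then 0 else E k))
          (\<lambda>x. subst_col (relation_matrix \<iota> \<kappa> (a x) (b x)) (tensor2 (a x (\<kappa> s)) (axis s 1)) i $ r $ c)"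
        for r c
      \<comment> \<open>In the replaced column only the entries with \<open>snd r = s\<close> can be
        nonzero, and these have exactly the row degree.\<close>
      proof (cases "c = i")
        case True
        then show ?thesis using a[of "\<kappa> s" "fst r"]
          by (cases "snd r = s") (simp_all add: subst_col_def axis_def multiform_zero)
      next
        case False
        then show ?thesis using N[of r c] by (simp add: subst_col_def)
      qed
    qed
    moreover have "(\<Sum>c\<in>UNIV. if c = i then 0 else E k) = (CARD('j \<times> 's) - 1) * E k" for k
      unfolding split[where f = "\<lambda>_. 0" and g = "\<lambda>k _. E k"] by (simp add: card_Diff_singleton)
    then have "(\<lambda>k. (\<Sum>r\<in>(UNIV :: ('j \<times> 's) set). unit_deg (\<kappa> (snd r)) k) +
        (\<Sum>c\<in>UNIV. if c = i then 0 else E k)) = Q"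
      by (intro ext) (simp only: Q_def)
    ultimately show ?thesis by (simp only: fibre_coord_def)
  qed
  have "multiform (\<lambda>k. 0 + (unit_deg (\<iota> c) k + Q k)) (\<lambda>x. segre_matrix \<iota> \<kappa> (a x) (b x) $ r $ c)" for r c
    using multiform.mult[OF a q] by (simp add: segre_matrix_def)
  from multiform.mult[OF multiform.mult[OF B multiform_det[OF N]] multiform_det[OF this]]
  show ?thesis unfolding discriminant_def by blast
qed

text \<open>Contractions recover vectors only up to nonzero scalars, which are absorbed into
  \<open>c\<close>. Reindexing the rows along \<tau> passes from the index type of the tensors to
  that of \<open>b\<close>.\<close>

lemma segre_through_scaled_points:
  fixes \<iota> :: "'j::finite \<times> 's::finite \<Rightarrow> 'k" and \<tau> :: "'j \<times> 's \<Rightarrow> 'y::finite"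
  assumes disc: "discriminant \<iota> \<kappa> (\<lambda>k. \<alpha> k *s a k) (\<lambda>k. \<beta> k *s (\<chi> r. b k $ \<tau> r)) \<noteq> 0"
    and cover: "range \<iota> \<union> range \<kappa> = UNIV" and \<tau>: "bij \<tau>"
    and nz: "\<And>k. \<alpha> k \<noteq> 0" "\<And>k. \<beta> k \<noteq> 0"
  shows "\<exists>M :: complex ^ ('j \<times> 's) ^ 'y. inj ((*v) M) \<and>
    (\<forall>k. \<exists>v c. v \<noteq> 0 \<and> c \<noteq> 0 \<and> M *v tensor2 (a k) v = c *s b k)"
proof -
  obtain M' :: "complex ^ ('j \<times> 's) ^ ('j \<times> 's)" where inj: "inj ((*v) M')" and M': "\<And>k. \<exists>v c. v \<noteq> 0 \<and> c \<noteq> 0 \<and>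
      M' *v tensor2 (\<alpha> k *s a k) v = c *s (\<beta> k *s (\<chi> r. b k $ \<tau> r))"
    using segre_through_points[OF disc cover] by blast
  define M where "M = (\<chi> y. M' $ inv \<tau> y)"
  have M: "(M *v x) $ \<tau> r = (M' *v x) $ r" for x r
    using \<tau> by (simp add: M_def matrix_vector_mult_def bij_is_inj)
  have eqI: "x = y" if "\<And>r. x $ \<tau> r = y $ \<tau> r" for x y :: "complex ^ 'y"
    using that \<tau> by (metis bij_pointE vec_eq_iff)
  have "inj ((*v) M)"
    using injD[OF inj] M by (intro injI) (metis vec_eq_iff)
  moreover have "\<exists>v c. v \<noteq> 0 \<and> c \<noteq> 0 \<and> M *v tensor2 (a k) v = c *s b k" for k
  proof -
    obtain v c where v: "v \<noteq> 0" "c \<noteq> 0"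
      and eq: "M' *v tensor2 (\<alpha> k *s a k) v = c *s (\<beta> k *s (\<chi> r. b k $ \<tau> r))"
      using M' by blast
    have "tensor2 (\<alpha> k *s a k) v = \<alpha> k *s tensor2 (a k) v" by (simp add: vec_eq_iff)
    then have "\<alpha> k * (M' *v tensor2 (a k) v) $ r = c * \<beta> k * b k $ \<tau> r" for r
      using arg_cong[OF eq, of "\<lambda>x. x $ r"] by (simp add: vector_scalar_commute)
    then have "M *v tensor2 (a k) v = (c * \<beta> k / \<alpha> k) *s b k"
      using nz by (intro eqI) (simp add: M field_simps)
    then show ?thesis using v nz by (metis divide_eq_0_iff mult_eq_0_iff)
  qed
  ultimately show ?thesis by blast
qed

section \<open>The genericity condition\<close>

text \<open>The contractions recover the factors of a decomposable tensor, up to scalars, as linear functions of it.\<close>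

definition contract1 :: "complex ^ ('a::finite \<times> 'b::finite \<times> 'c::finite) \<Rightarrow> complex ^ 'a" where
  "contract1 t = (\<chi> i. \<Sum>j\<in>UNIV. \<Sum>k\<in>UNIV. t $ (i, j, k))"

definition contract2 :: "complex ^ ('a::finite \<times> 'b::finite \<times> 'c::finite) \<Rightarrow> complex ^ 'b" where
  "contract2 t = (\<chi> j. \<Sum>i\<in>UNIV. \<Sum>k\<in>UNIV. t $ (i, j, k))"

definition contract3 :: "complex ^ ('a::finite \<times> 'b::finite \<times> 'c::finite) \<Rightarrow> complex ^ 'c" where
  "contract3 t = (\<chi> k. \<Sum>i\<in>UNIV. \<Sum>j\<in>UNIV. t $ (i, j, k))"

definition coord_sum :: "complex ^ 'n \<Rightarrow> complex" where
  "coord_sum v = (\<Sum>i\<in>UNIV. v $ i)"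

lemma contract_tensor3:
  "contract1 (tensor3 a b c) = (coord_sum b * coord_sum c) *s a"
  "contract2 (tensor3 a b c) = (coord_sum a * coord_sum c) *s b"
  "contract3 (tensor3 a b c) = (coord_sum a * coord_sum b) *s c"
  by (simp_all add: contract1_def contract2_def contract3_def coord_sum_def vec_eq_iff sum_product
      sum_distrib_left sum_distrib_right mult_ac) (rule allI, rule sum.swap)+

lemma multiform_contract:
  fixes k :: "'k::finite"
  shows "multiform (unit_deg k) (\<lambda>x. contract1 (x k) $ i)"
    and "multiform (unit_deg k) (\<lambda>x. contract2 (x k) $ j)"
    and "multiform (unit_deg k) (\<lambda>x. contract3 (x k) $ l)"
  unfolding contract1_def contract2_def contract3_def
  by (simp_all add: multiform_sum multiform.coord)

text \<open>The two discriminants treat the second and the third tensor factor with the same first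
  factor. On decomposable tensors the last product is nonzero only if all scalars produced by the
  contractions are nonzero.\<close>

definition genericity_form ::
  "(3 \<times> 2 \<Rightarrow> 'k) \<Rightarrow> (2 \<Rightarrow> 'k) \<Rightarrow> (3 \<times> 2 \<Rightarrow> 'y::finite) \<Rightarrow>
    ('k::finite \<Rightarrow> complex ^ (3 \<times> 'y \<times> 'y)) \<Rightarrow> complex" where
  "genericity_form \<iota> \<kappa> \<tau> x =
    discriminant \<iota> \<kappa> (\<lambda>k. contract1 (x k)) (\<lambda>k. \<chi> r. contract2 (x k) $ \<tau> r) *
    discriminant \<iota> \<kappa> (\<lambda>k. contract1 (x k)) (\<lambda>k. \<chi> r. contract3 (x k) $ \<tau> r) *
    (\<Prod>k\<in>UNIV. coord_sum (contract1 (x k)))"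

lemma multiform_genericity_form:
  fixes \<iota> :: "3 \<times> 2 \<Rightarrow> 'k::finite" and \<tau> :: "3 \<times> 2 \<Rightarrow> 'y::finite"
  shows "\<exists>d. multiform d (genericity_form \<iota> \<kappa> \<tau>)"
proof -
  have coord_sum: "multiform (\<lambda>k'. \<Sum>k\<in>UNIV. unit_deg k k')
      (\<lambda>x :: 'k \<Rightarrow> complex ^ (3 \<times> 'y \<times> 'y). \<Prod>k\<in>UNIV. coord_sum (contract1 (x k)))"
    unfolding coord_sum_def by (intro multiform_prod multiform_sum multiform_contract) auto
  obtain d where d: "multiform d (\<lambda>x :: 'k \<Rightarrow> complex ^ (3 \<times> 'y \<times> 'y).
      discriminant \<iota> \<kappa> (\<lambda>k. contract1 (x k)) (\<lambda>k. \<chi> r. contract2 (x k) $ \<tau> r))"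
    using multiform_discriminant[where a = "\<lambda>x k. contract1 (x k)" and
        b = "\<lambda>x k. \<chi> r. contract2 (x k) $ \<tau> r"] by (auto simp: multiform_contract)
  obtain e where e: "multiform e (\<lambda>x :: 'k \<Rightarrow> complex ^ (3 \<times> 'y \<times> 'y).
      discriminant \<iota> \<kappa> (\<lambda>k. contract1 (x k)) (\<lambda>k. \<chi> r. contract3 (x k) $ \<tau> r))"
    using multiform_discriminant[where a = "\<lambda>x k. contract1 (x k)" and
        b = "\<lambda>x k. \<chi> r. contract3 (x k) $ \<tau> r"] by (auto simp: multiform_contract)
  show ?thesis
    using multiform.mult[OF multiform.mult[OF d e] coord_sum] unfolding genericity_form_def[abs_def] by blast
qed

lemma genericity_form_nonzero:
  fixes \<tau> :: "3 \<times> 2 \<Rightarrow> 'y::finite" and e :: "3 \<times> 2 + 2 \<Rightarrow> 'k::finite"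
  assumes \<tau>: "bij \<tau>" and e: "bij e"
  shows "\<exists>a b c. (\<forall>k. a k \<noteq> 0 \<and> b k \<noteq> 0 \<and> c k \<noteq> 0) \<and>
    genericity_form (e \<circ> Inl) (e \<circ> Inr) \<tau> (\<lambda>k. tensor3 (a k) (b k) (c k)) \<noteq> 0"
proof -
  \<comment> \<open>A configuration for which all matrices of the construction are identity matrices; the factor
    \<open>1 / 9\<close> cancels the scalars that the contractions introduce.\<close>
  define a :: "'k \<Rightarrow> complex ^ 3" where
    "a k = (case inv e k of Inl i \<Rightarrow> axis (fst i) 1 | Inr s \<Rightarrow> 1)" for k
  define b' :: "'k \<Rightarrow> complex ^ (3 \<times> 2)" where
    "b' k = (case inv e k of Inl i \<Rightarrow> axis i 1 | Inr s \<Rightarrow> tensor2 1 (axis s 1))" for k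
  define b :: "'k \<Rightarrow> complex ^ 'y" where "b k = (\<chi> y. b' k $ inv \<tau> y)" for k
  define g :: "'k \<Rightarrow> complex" where "g k = (case inv e k of Inl i \<Rightarrow> 1 | Inr s \<Rightarrow> 1 / 9)" for k
  have inv_e: "inv e (e z) = z" for z using e by (simp add: bij_is_inj)
  have k_cases: "\<exists>z. k = e z" for k using e by (metis bij_pointE)
  have b_\<tau>: "(\<chi> r. b k $ \<tau> r) = b' k" for k
    using \<tau> by (simp add: b_def bij_is_inj vec_eq_iff)
  have coord_sum_b: "coord_sum (b k) = coord_sum (b' k)" for k
    using sum.reindex_bij_betw[OF bij_imp_bij_inv[OF \<tau>], of "\<lambda>r. b' k $ r"]
    by (simp add: coord_sum_def b_def)
  have coord_sum_tensor2: "coord_sum (tensor2 u v) = coord_sum u * coord_sum v"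
    for u :: "complex ^ 3" and v :: "complex ^ 2"
    by (simp add: coord_sum_def sum_product sum.cartesian_product split_def)
  have coord_sum_axis: "coord_sum (axis i 1) = 1" for i :: "'i::finite" by (simp add: coord_sum_def axis_def)
  have "coord_sum (1 :: complex ^ 3) = 3" by (simp add: coord_sum_def)
  then have "(coord_sum (a k) = 1 \<and> coord_sum (b k) = 1 \<and> g k = 1) \<or>
      (coord_sum (a k) = 3 \<and> coord_sum (b k) = 3 \<and> g k = 1 / 9)" for k
    using k_cases[of k]
    by (auto simp: a_def b'_def g_def inv_e coord_sum_b coord_sum_axis coord_sum_tensor2 split: sum.splits)
  note totals = this
  \<comment> \<open>The third factor is a multiple of the second, so both discriminants are
    evaluated on the same configuration.\<close>
  let ?x = "\<lambda>k. tensor3 (a k) (b k) (g k *s b k)"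
  have coord_sum_scale: "coord_sum (c *s v) = c * coord_sum v" for c and v :: "complex ^ 'i"
    by (simp add: coord_sum_def sum_distrib_left)
  have coord_sum_0: "coord_sum (0 :: complex ^ 'i) = 0" by (simp add: coord_sum_def)
  have coeffs: "coord_sum (b k) * (g k * coord_sum (b k)) = 1 \<and>
      coord_sum (a k) * (g k * coord_sum (b k)) = 1 \<and> coord_sum (a k) * coord_sum (b k) * g k = 1" for k
    using totals[of k] by (rule disjE) (simp_all add: mult.commute[of _ "g k"])
  have contr: "contract1 (?x k) = a k" "contract2 (?x k) = b k" "contract3 (?x k) = b k" for k
    using coeffs[of k] by (simp_all only: contract_tensor3 coord_sum_scale vector_smult_assoc vector_smult_lid)
  have "discriminant (e \<circ> Inl) (e \<circ> Inr) a b' = 1"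
    by (rule discriminant_eq_1) (simp_all add: a_def b'_def inv_e)
  moreover have nz: "coord_sum (a k) \<noteq> 0 \<and> coord_sum (b k) \<noteq> 0 \<and> g k \<noteq> 0" for k
    using totals[of k] by (rule disjE) auto
  ultimately have "genericity_form (e \<circ> Inl) (e \<circ> Inr) \<tau> ?x \<noteq> 0"
    unfolding genericity_form_def contr b_\<tau> by simp
  moreover have "a k \<noteq> 0 \<and> b k \<noteq> 0 \<and> g k *s b k \<noteq> 0" for k
  proof -
    have "a k \<noteq> 0" "b k \<noteq> 0" using nz[of k] by (auto simp: coord_sum_0)
    then show ?thesis using nz[of k] by (simp only: vector_mul_eq_0) simp
  qed
  ultimately show ?thesis
    by (intro exI[of _ a] exI[of _ b] exI[of _ "\<lambda>k. g k *s b k"]) simp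
qed

section \<open>Eight labelled points and the fourfold through them\<close>

lemma ex_bij_numerals:
  obtains \<tau> :: "3 \<times> 2 \<Rightarrow> 6" and e :: "3 \<times> 2 + 2 \<Rightarrow> 8" where "bij \<tau>" "bij e"
proof -
  have "card (UNIV :: (3 \<times> 2) set) = card (UNIV :: 6 set)"
    and "card (UNIV :: (3 \<times> 2 + 2) set) = card (UNIV :: 8 set)"
    by simp_all
  then show thesis using that by (metis finite finite_same_card_bij)
qed

theorem lemma3p2:
  fixes X :: "(complex ^ (3 \<times> 6 \<times> 6)) set set"
  assumes "X = segre_variety"
  shows "\<exists>U :: (8 \<Rightarrow> (complex ^ (3 \<times> 6 \<times> 6)) set) set.
    openin (subtopology zariski {x. \<forall>i. x i \<in> X}) U \<and> U \<noteq> {} \<and>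
    (\<forall>x\<in>U. \<exists>Y \<Lambda> \<phi>.
       Y \<subseteq> X \<and> (\<forall>i. x i \<in> Y) \<and>
       vec.subspace \<Lambda> \<and> vec.dim \<Lambda> = 40 \<and>
       embedding_by_3_1_1 \<Lambda> \<phi> \<and>
       Y = \<phi> ` (proj_space \<times> proj_space \<times> proj_space))"
proof -
  obtain \<tau> :: "3 \<times> 2 \<Rightarrow> 6" and e :: "3 \<times> 2 + 2 \<Rightarrow> 8" where \<tau>: "bij \<tau>" and e: "bij e"
    by (rule ex_bij_numerals)
  define \<iota> \<kappa> where "\<iota> = e \<circ> Inl" and "\<kappa> = e \<circ> Inr"
  have cover: "range \<iota> \<union> range \<kappa> = UNIV"
  proof -
    have "range \<iota> \<union> range \<kappa> = e ` UNIV"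
      unfolding \<iota>_def \<kappa>_def UNIV_sum by (simp add: image_Un image_comp)
    then show ?thesis using e by (simp add: bij_is_surj)
  qed
  let ?F = "genericity_form \<iota> \<kappa> \<tau>"
  define U where "U = basic_open ?F \<inter> {x. \<forall>i. x i \<in> X}"
  have "openin zariski (basic_open ?F)"
    using multiform_genericity_form unfolding zariski_def by (intro topology_generated_by_Basis) blast
  then have "openin (subtopology zariski {x. \<forall>i. x i \<in> X}) U"
    unfolding U_def openin_subtopology by blast
  moreover have "U \<noteq> {}"
  proof -
    obtain a b c where nz: "\<And>k. a k \<noteq> 0 \<and> b k \<noteq> 0 \<and> c k \<noteq> 0"
      and F: "?F (\<lambda>k. tensor3 (a k) (b k) (c k)) \<noteq> 0"
      using genericity_form_nonzero[OF \<tau> e] unfolding \<iota>_def \<kappa>_def by blast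
    have "(\<lambda>k. proj_pt (tensor3 (a k) (b k) (c k))) \<in> basic_open ?F"
      unfolding basic_open_def using F nz
      by (intro CollectI exI[of _ "\<lambda>k. tensor3 (a k) (b k) (c k)"]) (simp add: tensor3_eq_0_iff)
    moreover have "proj_pt (tensor3 (a k) (b k) (c k)) \<in> X" for k
      unfolding assms segre_variety_def using nz by blast
    ultimately show ?thesis unfolding U_def by blast
  qed
  moreover have "\<exists>Y \<Lambda> \<phi>. Y \<subseteq> X \<and> (\<forall>i. x i \<in> Y) \<and> vec.subspace \<Lambda> \<and> vec.dim \<Lambda> = 40 \<and>
      embedding_by_3_1_1 \<Lambda> \<phi> \<and> Y = \<phi> ` (proj_space \<times> proj_space \<times> proj_space)"
    if x_U: "x \<in> U" for x
  proof -
    obtain t where x: "x = (\<lambda>k. proj_pt (t k))" and t: "\<And>k. t k \<noteq> 0" "?F t \<noteq> 0"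
      using x_U unfolding U_def basic_open_def by blast
    have X: "x k \<in> X" for k using x_U by (simp add: U_def)
    \<comment> \<open>The lift \<open>t k\<close> is a multiple of a decomposable tensor; absorbing
      the scalar in the first factor makes the contraction formulas applicable.\<close>
    have "\<exists>a b c. a \<noteq> 0 \<and> b \<noteq> 0 \<and> c \<noteq> 0 \<and> t k = tensor3 a b c" for k
    proof -
      obtain a b c where abc: "a \<noteq> 0" "b \<noteq> 0" "c \<noteq> 0" and "proj_pt (t k) = proj_pt (tensor3 a b c)"
        using X[of k] by (auto simp: x assms segre_variety_def)
      then obtain d where "d \<noteq> 0" "t k = d *s tensor3 a b c" using t(1) proj_pt_eqE by blast
      then have "t k = tensor3 (d *s a) b c" "d *s a \<noteq> 0" using abc by simp_all
      then show ?thesis using abc by blast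
    qed
    then obtain a b c where nz: "\<And>k. a k \<noteq> 0" "\<And>k. b k \<noteq> 0" "\<And>k. c k \<noteq> 0"
      and tk: "t = (\<lambda>k. tensor3 (a k) (b k) (c k))"
      by metis
    let ?\<alpha> = "\<lambda>k. coord_sum (b k) * coord_sum (c k)"
    \<comment> \<open>This is the product of the coordinate sums of \<open>a k\<close>,
      \<open>b k\<close> and \<open>c k\<close>, so none of the three vanishes.\<close>
    have "coord_sum (?\<alpha> k *s a k) \<noteq> 0" for k
      using t(2) by (simp add: genericity_form_def tk contract_tensor3)
    then have totals: "coord_sum (a k) \<noteq> 0" "coord_sum (b k) \<noteq> 0" "coord_sum (c k) \<noteq> 0" for k
      by (auto simp: coord_sum_def simp flip: sum_distrib_left)
    have scale: "(\<chi> r. (d *s v) $ \<tau> r) = d *s (\<chi> r. v $ \<tau> r)" for d and v :: "complex ^ 6"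
      by (simp add: vec_eq_iff)
    have disc: "discriminant \<iota> \<kappa> (\<lambda>k. ?\<alpha> k *s a k) (\<lambda>k. (coord_sum (a k) * coord_sum (c k)) *s (\<chi> r. b k $ \<tau> r)) \<noteq> 0"
      "discriminant \<iota> \<kappa> (\<lambda>k. ?\<alpha> k *s a k) (\<lambda>k. (coord_sum (a k) * coord_sum (b k)) *s (\<chi> r. c k $ \<tau> r)) \<noteq> 0"
      using t(2) unfolding genericity_form_def tk contract_tensor3 scale by simp_all
    \<comment> \<open>The two matrices are found separately, one for the points \<open>b k\<close>
      and one for the points \<open>c k\<close>; only the first factors \<open>a k\<close> are
      shared.\<close>
    obtain M :: "complex ^ (3 \<times> 2) ^ 6" where M: "inj ((*v) M)"
      and M_pts: "\<And>k. \<exists>v d. v \<noteq> 0 \<and> d \<noteq> 0 \<and> M *v tensor2 (a k) v = d *s b k"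
      using segre_through_scaled_points[OF disc(1) cover \<tau>] totals by auto
    obtain N :: "complex ^ (3 \<times> 2) ^ 6" where N: "inj ((*v) N)"
      and N_pts: "\<And>k. \<exists>w d. w \<noteq> 0 \<and> d \<noteq> 0 \<and> N *v tensor2 (a k) w = d *s c k"
      using segre_through_scaled_points[OF disc(2) cover \<tau>] totals by auto
    let ?Y = "fourfold_map M N ` (proj_space \<times> proj_space \<times> proj_space)"
    have "x k \<in> ?Y" for k
    proof -
      obtain v d where v: "v \<noteq> 0" "d \<noteq> 0" "M *v tensor2 (a k) v = d *s b k" using M_pts by blast
      obtain w d' where w: "w \<noteq> 0" "d' \<noteq> 0" "N *v tensor2 (a k) w = d' *s c k" using N_pts by blast
      have "fourfold_map M N (proj_pt (a k), proj_pt v, proj_pt w) = x k"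
        by (simp add: fourfold_map_proj_pt v w x tk proj_pt_scale del: vector_smult_assoc)
      moreover have "(proj_pt (a k), proj_pt v, proj_pt w) \<in> proj_space \<times> proj_space \<times> proj_space"
        using nz v w by (auto simp: proj_space_def)
      ultimately show ?thesis by (metis imageI)
    qed
    moreover have "?Y \<subseteq> X" unfolding assms by (rule fourfold_subset_segre[OF M N])
    ultimately show ?thesis using embedding_fourfold_map[OF M N] by metis
  qed
  ultimately show ?thesis by blast
qed

end
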